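(* Let $A$ be an $n\times n$ complex EP matrix and let $X,Y$ be $n\times p$ complex matrices. Put $\mathcal X=\operatorname{im}(X)$, $\mathcal Y=\operatorname{im}(Y)$, $\mathcal A=\operatorname{im}(A)$, $P_{\mathcal A}=AA^{\dagger}$, and $$P=I-X(Y^{*}X)^{\dagger}Y^{*},\qquad N=I-P+AP.$$ Suppose that $$\mathcal X\oplus A\mathcal Y^{\perp}=\mathbb C^n,\qquad \mathcal X\oplus\mathcal Y^{\perp}=\mathbb C^n,\qquad \mathcal A^{\perp}\subseteq\mathcal X\cap\mathcal Y,\qquad \ker(P_{\mathcal A}X)\cap\ker(P_{\mathcal A}Y)^{\perp}=\{0\}.$$ Then $N$ is non-singular and $$|A|_{\dagger}\,|Y^{*}A^{\dagger}X|_{\dagger}=|Y^{*}AA^{\dagger}X|_{\dagger}\,|N|.$$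
   Context: $(\cdot)^{\dagger}$ is the Moore-Penrose pseudo-inverse, $(\cdot)^{*}$ the conjugate transpose, $(\cdot)^{\perp}$ the orthogonal complement. $|\cdot|$ denotes the determinant. $|\cdot|_{\dagger}$ denotes the pseudo-determinant of a square matrix: the product of its non-zero eigenvalues (with algebraic multiplicity), with value $1$ for a nilpotent matrix. A square matrix $A$ is EP (range-Hermitian) if $\operatorname{im}(A)=\operatorname{im}(A^{*})$. *)

theory Defs
  imports
    Complex_Main
    "Jordan_Normal_Form.Matrix_Kernel"
    "Jordan_Normal_Form.Schur_Decomposition"
    "Jordan_Normal_Form.Spectral_Radius"
begin

definition mat_image :: "complex mat \<Rightarrow> complex vec set" where
  "mat_image A = (\<lambda>v. A *\<^sub>v v) ` carrier_vec (dim_col A)"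

(* Orthogonality is with respect to the Hermitian inner product; the library's
   orthogonal_complement uses the bilinear scalar product instead. *)
definition orth_compl :: "nat \<Rightarrow> complex vec set \<Rightarrow> complex vec set" where
  "orth_compl n W = {v \<in> carrier_vec n. \<forall>w\<in>W. v \<bullet>c w = 0}"

(* For subspaces U, V of C^n: the internal direct sum of U and V is all of C^n. *)
definition direct_sum_eq_space :: "nat \<Rightarrow> complex vec set \<Rightarrow> complex vec set \<Rightarrow> bool" where
  "direct_sum_eq_space n U V \<longleftrightarrow>
     {u + v | u v. u \<in> U \<and> v \<in> V} = carrier_vec n \<and> U \<inter> V = {0\<^sub>v n}"

(* The four Penrose equations. *)
definition is_pinv :: "complex mat \<Rightarrow> complex mat \<Rightarrow> bool" where
  "is_pinv A B \<longleftrightarrow>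
     B \<in> carrier_mat (dim_col A) (dim_row A) \<and>
     A * B * A = A \<and> B * A * B = B \<and>
     mat_adjoint (A * B) = A * B \<and> mat_adjoint (B * A) = B * A"

definition pinv :: "complex mat \<Rightarrow> complex mat" where
  "pinv A = (THE B. is_pinv A B)"

(* The exponent is the algebraic multiplicity of the eigenvalue; the empty product
   gives the value 1 for nilpotent matrices. *)
definition pdet :: "complex mat \<Rightarrow> complex" where
  "pdet A = (\<Prod>a\<in>spectrum A - {0}. a ^ Polynomial.order a (char_poly A))"

definition EP_mat :: "complex mat \<Rightarrow> bool" where
  "EP_mat A \<longleftrightarrow> square_mat A \<and> mat_image A = mat_image (mat_adjoint A)"

end

theory Submission
  imports Defs
begin

text \<open>
  If \<open>S\<close> is an idempotent with \<open>S M = M S = M\<close> and \<open>1 - S + M\<close> is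
  non-singular, then \<open>pdet M = det (1 - S + M)\<close>, so every pseudo-determinant in the identity is
  an ordinary determinant. For \<open>A\<close> the idempotent is \<open>PA\<close>, since an EP matrix
  commutes with its pseudo-inverse. For \<open>R = Y\<^sup>* PA X\<close> the kernel condition gives
  \<open>ker R\<^sup>2 = ker R\<close>, hence an idempotent with the range and kernel of \<open>R\<close>,
  which also serves for \<open>M = Y\<^sup>* A\<^sup>\<dagger> X\<close>.
  The second direct sum makes \<open>Q = 1 - P\<close> the projection onto \<open>im X\<close> along the orthogonal
  complement of \<open>im Y\<close>, and the inclusion makes \<open>Q\<close> commute with \<open>PA\<close>. Both
  \<open>det N / pdet A\<close> and, after exchanging factors in \<open>det (1 + F G) = det (1 + G F)\<close>,
  \<open>pdet M / pdet R\<close> then equal \<open>det (1 + (A\<^sup>\<dagger> - 1) PA Q)\<close>.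
\<close>

text \<open>The side conditions here and below are equations between dimensions rather than carrier
  memberships. The rules then rewrite without guessing carrier indices, and together they multiply
  products out and bracket them to the right.\<close>

lemma mult_assoc_dim:
  fixes A B C :: "'a :: semiring_0 mat"
  assumes "dim_col A = dim_row B" "dim_col B = dim_row C"
  shows "A * B * C = A * (B * C)"
  using assms by (intro assoc_mult_mat) auto

lemma add_mult_distrib_dim:
  fixes A B C :: "'a :: semiring_0 mat"
  assumes "dim_row A = dim_row B" "dim_col A = dim_row C" "dim_col B = dim_row C"
  shows "(A + B) * C = A * C + B * C"
  using assms by (intro add_mult_distrib_mat) auto

lemma mult_add_distrib_dim:
  fixes A B C :: "'a :: semiring_0 mat"
  assumes "dim_col A = dim_row B" "dim_row B = dim_row C" "dim_col B = dim_col C"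
  shows "A * (B + C) = A * B + A * C"
  using assms by (intro mult_add_distrib_mat) auto

lemma minus_mult_distrib_dim:
  fixes A B C :: "'a :: ring mat"
  assumes "dim_row A = dim_row B" "dim_col A = dim_row C" "dim_col B = dim_row C"
  shows "(A - B) * C = A * C - B * C"
  using assms by (intro minus_mult_distrib_mat) auto

lemma mult_minus_distrib_dim:
  fixes A B C :: "'a :: ring mat"
  assumes "dim_col A = dim_row B" "dim_row B = dim_row C" "dim_col B = dim_col C"
  shows "A * (B - C) = A * B - A * C"
  using assms by (intro mult_minus_distrib_mat) auto

lemma mult_vec_assoc_dim:
  fixes A B :: "'a :: semiring_0 mat"
  assumes "dim_col A = dim_row B" "dim_col B = dim_vec v"
  shows "A * B *\<^sub>v v = A *\<^sub>v (B *\<^sub>v v)"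
  using assms by (intro assoc_mult_mat_vec) auto

lemma add_mult_vec_distrib_dim:
  fixes A B :: "'a :: semiring_0 mat"
  assumes "dim_row A = dim_row B" "dim_col A = dim_vec v" "dim_col B = dim_vec v"
  shows "(A + B) *\<^sub>v v = A *\<^sub>v v + B *\<^sub>v v"
  using assms by (intro add_mult_distrib_mat_vec) (auto intro: carrier_vecI)

lemma minus_mult_vec_distrib_dim:
  fixes A B :: "'a :: ring mat"
  assumes "dim_row A = dim_row B" "dim_col A = dim_vec v" "dim_col B = dim_vec v"
  shows "(A - B) *\<^sub>v v = A *\<^sub>v v - B *\<^sub>v v"
  using assms by (intro minus_mult_distrib_mat_vec) (auto intro: carrier_vecI)

lemma one_mult_vec_dim: "dim_vec v = n \<Longrightarrow> 1\<^sub>m n *\<^sub>v v = (v :: 'a :: semiring_1 vec)"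
  by (intro one_mult_mat_vec) (auto intro: carrier_vecI)

lemma mult_zero_vec_dim: "dim_col A = n \<Longrightarrow> A *\<^sub>v 0\<^sub>v n = (0\<^sub>v (dim_row A) :: 'a :: semiring_0 vec)"
  by (intro eq_vecI) auto

lemmas mult_vec_dim_simps = mult_vec_assoc_dim mult_zero_vec_dim add_mult_vec_distrib_dim
  minus_mult_vec_distrib_dim one_mult_vec_dim

lemma col_mult_dim:
  fixes A B :: "'a :: semiring_0 mat"
  assumes "dim_col A = dim_row B" "j < dim_col B"
  shows "col (A * B) j = A *\<^sub>v col B j"
  using assms by (intro col_mult2) auto

lemma one_mult_dim: "dim_row A = n \<Longrightarrow> 1\<^sub>m n * A = (A :: 'a :: semiring_1 mat)"
  by (intro left_mult_one_mat) auto

lemma mult_one_dim: "dim_col A = n \<Longrightarrow> A * 1\<^sub>m n = (A :: 'a :: semiring_1 mat)"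
  by (intro right_mult_one_mat) auto

lemma minus_self_dim: "A - A = 0\<^sub>m (dim_row A) (dim_col A)"
  for A :: "'a :: ab_group_add mat"
  by (intro eq_matI) auto

lemmas mat_dim_simps = minus_self_dim mult_assoc_dim add_mult_distrib_dim mult_add_distrib_dim
  minus_mult_distrib_dim mult_minus_distrib_dim one_mult_dim mult_one_dim

section \<open>Adjoints and the Hermitian inner product\<close>

lemma mat_adjoint_dim [simp]:
  "dim_row (mat_adjoint A) = dim_col A" "dim_col (mat_adjoint A) = dim_row A"
  by (auto simp: mat_adjoint_def)

lemma mat_adjoint_index [simp]:
  assumes "i < dim_col A" "j < dim_row A"
  shows "mat_adjoint A $$ (i, j) = conjugate (A $$ (j, i))"
  using assms by (simp add: mat_adjoint_def mat_of_rows_index)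

lemma mat_adjoint_mat_adjoint [simp]: "mat_adjoint (mat_adjoint A) = A"
  by (intro eq_matI) auto

lemma mat_adjoint_one [simp]: "mat_adjoint (1\<^sub>m n) = (1\<^sub>m n :: complex mat)"
  by (intro eq_matI) auto

lemma mat_adjoint_mult:
  fixes A B :: "complex mat"
  assumes "dim_col A = dim_row B"
  shows "mat_adjoint (A * B) = mat_adjoint B * mat_adjoint A"
  using assms by (intro eq_matI) (auto simp: scalar_prod_def mult.commute intro!: sum.cong)

lemma mat_adjoint_minus:
  fixes A B :: "complex mat"
  assumes "dim_row A = dim_row B" "dim_col A = dim_col B"
  shows "mat_adjoint (A - B) = mat_adjoint A - mat_adjoint B"
  using assms by (intro eq_matI) auto

lemma cscalar_prod_mult_mat_vec:
  fixes A :: "complex mat"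
  assumes "v \<in> carrier_vec (dim_col A)" "w \<in> carrier_vec (dim_row A)"
  shows "(A *\<^sub>v v) \<bullet>c w = v \<bullet>c (mat_adjoint A *\<^sub>v w)"
proof -
  have "(A *\<^sub>v v) \<bullet>c w
      = (\<Sum>i<dim_row A. \<Sum>j<dim_col A. A $$ (i, j) * v $ j * cnj (w $ i))"
    using assms by (auto simp: scalar_prod_def sum_distrib_right lessThan_atLeast0 intro!: sum.cong)
  also have "\<dots> = (\<Sum>j<dim_col A. \<Sum>i<dim_row A. A $$ (i, j) * v $ j * cnj (w $ i))"
    by (rule sum.swap)
  also have "\<dots> = v \<bullet>c (mat_adjoint A *\<^sub>v w)"
    using assms
    by (auto simp: scalar_prod_def sum_distrib_left lessThan_atLeast0 mult_ac intro!: sum.cong)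
  finally show ?thesis .
qed

section \<open>Cancellation and factorisation, column by column\<close>

text \<open>Each column of \<open>Z - Z'\<close> lies in the kernel of \<open>A\<close>, hence in
  that of \<open>B\<close>. Kernel inclusions thus become matrix equations.\<close>

lemma mult_mat_cancel_if_kernel:
  fixes A B :: "'a :: comm_ring_1 mat"
  assumes ker: "\<And>v. \<lbrakk>v \<in> carrier_vec (dim_col A); A *\<^sub>v v = 0\<^sub>v (dim_row A)\<rbrakk>
      \<Longrightarrow> B *\<^sub>v v = 0\<^sub>v (dim_row B)"
    and dims: "dim_col B = dim_col A" "dim_row Z = dim_col A" "dim_row Z' = dim_col A"
      "dim_col Z = dim_col Z'"
    and eq: "A * Z = A * Z'"
  shows "B * Z = B * Z'"
proof (rule mat_col_eqI)
  fix j assume j: "j < dim_col (B * Z')"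
  let ?v = "col Z j - col Z' j"
  have c: "col Z j \<in> carrier_vec (dim_col A)" "col Z' j \<in> carrier_vec (dim_col A)"
    using dims by (simp_all add: carrier_dim_vec)
  have "A *\<^sub>v ?v = A *\<^sub>v col Z j - A *\<^sub>v col Z' j"
    using c dims by (intro mult_minus_distrib_mat_vec[of A "dim_row A" "dim_col A"]) auto
  also have "A *\<^sub>v col Z j = col (A * Z) j" using j dims by (simp add: col_mult_dim)
  also have "A *\<^sub>v col Z' j = col (A * Z) j"
    unfolding eq using j dims by (simp add: col_mult_dim)
  finally have "A *\<^sub>v ?v = 0\<^sub>v (dim_row A)" by (simp add: carrier_dim_vec)
  then have "B *\<^sub>v ?v = 0\<^sub>v (dim_row B)"
    using c by (intro ker) auto
  moreover have "B *\<^sub>v ?v = B *\<^sub>v col Z j - B *\<^sub>v col Z' j"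
    using c dims by (intro mult_minus_distrib_mat_vec[of B "dim_row B" "dim_col B"]) auto
  ultimately have *: "B *\<^sub>v col Z j - B *\<^sub>v col Z' j = 0\<^sub>v (dim_row B)" by simp
  have "B *\<^sub>v col Z j = B *\<^sub>v col Z' j"
  proof (rule eq_vecI)
    fix i assume "i < dim_vec (B *\<^sub>v col Z' j)"
    with arg_cong[OF *, of "\<lambda>v. v $ i"]
    show "(B *\<^sub>v col Z j) $ i = (B *\<^sub>v col Z' j) $ i" by auto
  qed auto
  then show "col (B * Z) j = col (B * Z') j"
    using j dims by (simp add: col_mult_dim)
qed (use dims in auto)

lemma mult_unit_vec_eq_col:
  "j < dim_col A \<Longrightarrow> A *\<^sub>v unit_vec (dim_col A) j = col A j"
  for A :: "'a :: semiring_1 mat"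
  by (intro eq_vecI) auto

text \<open>The columns of \<open>E\<close> are images of unit vectors, so each one is
  \<open>X\<close> applied to some vector; these vectors are the columns of
  \<open>F\<close>.\<close>

lemma mat_factor_if_image_subset:
  fixes E X :: "complex mat"
  assumes E: "E \<in> carrier_mat n m" and X: "X \<in> carrier_mat n p"
    and sub: "\<And>v. v \<in> carrier_vec m \<Longrightarrow> E *\<^sub>v v \<in> mat_image X"
  shows "\<exists>F\<in>carrier_mat p m. E = X * F"
proof -
  note dims = carrier_matD[OF E] carrier_matD[OF X]
  have "\<exists>f. f \<in> carrier_vec p \<and> col E j = X *\<^sub>v f" if "j < m" for j
    using sub[of "unit_vec m j"] that mult_unit_vec_eq_col[of j E] by (auto simp: mat_image_def dims)
  then obtain f where f: "\<And>j. j < m \<Longrightarrow> f j \<in> carrier_vec p \<and> col E j = X *\<^sub>v f j"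
    by metis
  let ?F = "mat p m (\<lambda>(i, j). f j $ i)"
  have "E = X * ?F"
  proof (rule mat_col_eqI)
    fix j assume j: "j < dim_col (X * ?F)"
    then have "col ?F j = f j" using f[of j] by (intro eq_vecI) auto
    with j f[of j] show "col E j = col (X * ?F) j" by (simp add: col_mult_dim dims)
  qed (auto simp: dims)
  then show ?thesis by (intro bexI[of _ ?F]) auto
qed

subsection \<open>Pseudo-determinants as determinants\<close>

text \<open>Sylvester's determinant identity. Both products of the block matrices \<open>?K\<close>
  and \<open>?L\<close> are block upper triangular, and their determinants are the two
  sides.\<close>

lemma det_one_plus_mult_commute:
  fixes A B :: "'a :: idom mat"
  assumes A: "A \<in> carrier_mat n p" and B: "B \<in> carrier_mat p n"
  shows "det (1\<^sub>m n + A * B) = det (1\<^sub>m p + B * A)"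
proof -
  let ?K = "four_block_mat (1\<^sub>m n) A (- B) (1\<^sub>m p)"
  let ?L = "four_block_mat (1\<^sub>m n) (0\<^sub>m n p) B (1\<^sub>m p)"
  have c: "?K \<in> carrier_mat (n + p) (n + p)" "?L \<in> carrier_mat (n + p) (n + p)" by auto
  have "- B * A = - (B * A)" using A B by (auto intro: uminus_mult_left_mat)
  then have KL: "?K * ?L = four_block_mat (1\<^sub>m n + A * B) A (0\<^sub>m p n) (1\<^sub>m p)"
    and LK: "?L * ?K = four_block_mat (1\<^sub>m n) A (0\<^sub>m p n) (1\<^sub>m p + B * A)"
    using A B
    by (simp_all add: mult_four_block_mat[of _ n n _ p _ p _ _ n _ p] comm_add_mat[of _ p p])
      (rule cong_four_block_mat; auto)+
  have "det (1\<^sub>m n + A * B) = det (?K * ?L)"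
    unfolding KL using A B by (subst det_four_block_mat_lower_left_zero[of _ n _ p]) auto
  also have "\<dots> = det (?L * ?K)"
    by (simp add: det_mult[OF c] det_mult[OF c(2,1)])
  also have "\<dots> = det (1\<^sub>m p + B * A)"
    unfolding LK using A B by (subst det_four_block_mat_lower_left_zero[of _ n _ p]) auto
  finally show ?thesis .
qed

text \<open>The roots of \<open>q\<close> are the non-zero eigenvalues with the same multiplicities,
  and \<open>q\<close> is monic, so by Vieta its constant term is their product up to sign.\<close>

lemma pdet_eq_if_char_poly_factor:
  assumes A: "A \<in> carrier_mat n n"
    and cp: "char_poly A = [:0, 1:] ^ j * q" and q0: "poly q 0 \<noteq> 0"
  shows "pdet A = (- 1) ^ degree q * poly q 0"
proof -
  let ?R = "{z. poly q z = 0}"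
  have "q \<noteq> 0" using q0 by auto
  have "lead_coeff ([:0, 1:] ^ j * q) = 1"
    using degree_monic_char_poly[OF A] cp by simp
  then have lc: "lead_coeff q = 1" by (simp add: lead_coeff_mult lead_coeff_power)
  have dec: "(\<Prod>z\<in>?R. [:- z, 1:] ^ order z q) = q"
    using complex_poly_decompose[of q] lc by simp
  have "degree q = degree (\<Prod>z\<in>?R. [:- z, 1:] ^ order z q)" by (simp add: dec)
  also have "\<dots> = (\<Sum>z\<in>?R. order z q)"
    by (subst degree_prod_sum_eq) (auto simp: degree_power_eq)
  finally have deg: "degree q = (\<Sum>z\<in>?R. order z q)" .
  have "poly q 0 = poly (\<Prod>z\<in>?R. [:- z, 1:] ^ order z q) 0" by (simp add: dec)
  also have "\<dots> = (\<Prod>z\<in>?R. (- 1) ^ order z q * z ^ order z q)"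
    by (simp add: poly_prod power_mult_distrib[symmetric])
  also have "\<dots> = (- 1) ^ degree q * (\<Prod>z\<in>?R. z ^ order z q)"
    by (simp add: prod.distrib deg power_sum)
  finally have 1: "(- 1) ^ degree q * poly q 0 = (\<Prod>z\<in>?R. z ^ order z q)"
    by (simp add: mult.assoc[symmetric] power_mult_distrib[symmetric])
  have "spectrum A - {0} = ?R"
    using q0 by (auto simp: spectrum_root_char_poly[OF A] cp poly_power)
  moreover have "order z (char_poly A) = order z q" if "z \<in> ?R" for z
  proof -
    have "poly ([:0, 1:] ^ j) z \<noteq> 0" using that q0 by (auto simp: poly_power)
    then have "order z ([:0, 1:] ^ j) = 0" by (rule order_0I)
    then show ?thesis unfolding cp using \<open>q \<noteq> 0\<close> by (subst order_mult) auto
  qed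
  ultimately show ?thesis unfolding pdet_def 1 by simp
qed

text \<open>Take the determinant over the polynomial ring, with linear entries; evaluation at
  \<open>x\<close> commutes with it.\<close>

lemma ex_poly_eq_det_pencil:
  fixes A B :: "'a :: comm_ring_1 mat"
  assumes "A \<in> carrier_mat n n" "B \<in> carrier_mat n n"
  shows "\<exists>q. \<forall>x. poly q x = det (A + x \<cdot>\<^sub>m B)"
proof (intro exI allI)
  fix x
  show "poly (det (mat n n (\<lambda>(i, j). [:A $$ (i, j), B $$ (i, j):]))) x = det (A + x \<cdot>\<^sub>m B)"
    using assms by (intro poly_det_cong[of _ n]) auto
qed

lemma smult_mult_dim:
  fixes A B :: "'a :: comm_semiring_0 mat"
  assumes "dim_col A = dim_row B"
  shows "(c \<cdot>\<^sub>m A) * B = c \<cdot>\<^sub>m (A * B)" "A * (c \<cdot>\<^sub>m B) = c \<cdot>\<^sub>m (A * B)"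
  using assms by (auto intro: mult_smult_assoc_mat mult_smult_distrib)

text \<open>Along the splitting into the range and the kernel of \<open>S\<close>, \<open>M\<close>
  is a block on the range and zero on the kernel, while \<open>1 - S + M\<close> is the same block
  and the identity. The block is thus invertible, and its determinant is the product of the non-zero
  eigenvalues. Determinants of pencils express this without a choice of bases.\<close>

lemma pdet_eq_det_if_idempotent:
  fixes S M :: "complex mat"
  assumes S: "S \<in> carrier_mat n n" and M: "M \<in> carrier_mat n n"
    and SS: "S * S = S" and SM: "S * M = M" and MS: "M * S = M"
    and nz: "det (1\<^sub>m n - S + M) \<noteq> 0"
  shows "pdet M = det (1\<^sub>m n - S + M)"
proof -
  let ?T = "1\<^sub>m n - S"
  note dims = carrier_matD[OF S] carrier_matD[OF M]
  note simps = mat_dim_simps smult_mult_dim dims SS SM MS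
  have c: "?T \<in> carrier_mat n n" "?T - M \<in> carrier_mat n n"
    and c2: "S + x \<cdot>\<^sub>m ?T \<in> carrier_mat n n" "?T + x \<cdot>\<^sub>m S \<in> carrier_mat n n"
      "(?T - M) + x \<cdot>\<^sub>m S \<in> carrier_mat n n" for x
    using S M by auto
  obtain r where r: "\<And>x. poly r x = det (S + x \<cdot>\<^sub>m ?T)"
    using ex_poly_eq_det_pencil[OF S c(1)] by auto
  obtain r' where r': "\<And>x. poly r' x = det (?T + x \<cdot>\<^sub>m S)"
    using ex_poly_eq_det_pencil[OF c(1) S] by auto
  obtain q where q: "\<And>x. poly q x = det ((?T - M) + x \<cdot>\<^sub>m S)"
    using ex_poly_eq_det_pencil[OF c(2) S] by auto
  have rr': "poly r x * poly r' x = x ^ n" for x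
  proof -
    have "(S + x \<cdot>\<^sub>m ?T) * (?T + x \<cdot>\<^sub>m S) = x \<cdot>\<^sub>m 1\<^sub>m n"
      by (simp add: simps)
        (rule eq_matI; auto simp: dims algebra_simps simp del: index_mult_mat(1))
    then show ?thesis
      unfolding r r' by (simp flip: det_mult[OF c2(1,2)])
  qed
  \<comment> \<open>\<open>x - M = (S + x (1 - S)) (1 - S - M + x S)\<close>, and the first factor has determinant
    a power of \<open>x\<close> because its product with \<open>1 - S + x S\<close> is \<open>x\<close>.\<close>
  have cp: "char_poly M = r * q"
  proof -
    have "poly (char_poly M) x = poly (r * q) x" for x
    proof -
      have "(S + x \<cdot>\<^sub>m ?T) * ((?T - M) + x \<cdot>\<^sub>m S) = - char_matrix M x"
        unfolding char_matrix_def
        by (simp add: simps)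
          (rule eq_matI; auto simp: dims algebra_simps simp del: index_mult_mat(1))
      then show ?thesis
        unfolding poly_mult r q char_poly_matrix[OF M] by (simp flip: det_mult[OF c2(1,3)])
    qed
    then show ?thesis by (simp flip: poly_eq_poly_eq_iff add: fun_eq_iff)
  qed
  have "S + 1 \<cdot>\<^sub>m ?T = 1\<^sub>m n" by (rule eq_matI) (auto simp: dims)
  then have r1: "poly r 1 = 1" by (simp add: r)
  define j where "j = order 0 r"
  \<comment> \<open>Since \<open>r * r'\<close> takes the values \<open>x ^ n\<close>, only 0 can be
    a root of \<open>r\<close>; the value at 1 fixes the leading coefficient.\<close>
  have r_eq: "r = [:0, 1:] ^ j"
  proof -
    have sub: "{z. poly r z = 0} \<subseteq> {0}"
      using rr' by (metis (mono_tags, lifting) mem_Collect_eq mult_zero_left power_not_zero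
          singletonI subsetI)
    have "r \<noteq> 0" using r1 by auto
    then have "(\<Prod>z | poly r z = 0. [:- z, 1:] ^ order z r) = (\<Prod>z\<in>{0}. [:- z, 1:] ^ order z r)"
      using sub by (intro prod.mono_neutral_left) (auto simp: order_0I)
    also have "\<dots> = [:0, 1:] ^ j" by (simp add: j_def)
    finally obtain c where c: "r = smult c ([:0, 1:] ^ j)"
      using complex_poly_decompose[of r] by metis
    with r1 have "c = 1" by (simp add: poly_power)
    with c show ?thesis by simp
  qed
  \<comment> \<open>Multiplication by \<open>S - ?T\<close>, the first pencil at -1, turns
    \<open>?T + M\<close> into \<open>-(?T - M)\<close>; its determinant is
    \<open>poly r (- 1)\<close>, that is \<open>(- 1) ^ j\<close>.\<close>
  have q0: "poly q 0 = (- 1) ^ (n + j) * det (?T + M)"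
  proof -
    have "(S + (- 1) \<cdot>\<^sub>m ?T) * (?T + M) = (- 1) \<cdot>\<^sub>m ((?T - M) + 0 \<cdot>\<^sub>m S)"
      by (simp add: simps)
        (rule eq_matI; auto simp: dims algebra_simps simp del: index_mult_mat(1))
    then have "det (S + (- 1) \<cdot>\<^sub>m ?T) * det (?T + M) = (- 1) ^ n * poly q 0"
      unfolding q using S M by (subst det_mult[symmetric, of _ n]) (auto simp: det_smult)
    then have "(- 1) ^ j * det (?T + M) = (- 1) ^ n * poly q 0"
      unfolding r[symmetric] by (simp add: r_eq poly_power)
    then have "(- 1) ^ n * ((- 1) ^ j * det (?T + M)) = poly q 0"
      by (simp add: mult.assoc[symmetric] power_mult_distrib[symmetric])
    then show ?thesis by (simp add: power_add mult.assoc)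
  qed
  have "poly q 0 \<noteq> 0" using nz by (simp add: q0)
  \<comment> \<open>Comparing degrees gives \<open>n = j + degree q\<close>, so the signs from
    \<open>q0\<close> and from the constant term of \<open>q\<close> cancel.\<close>
  moreover from this have "degree (char_poly M) = j + degree q"
    unfolding cp r_eq by (subst degree_mult_eq) (auto simp: degree_power_eq)
  then have "n = j + degree q" using degree_monic_char_poly[OF M] by simp
  then have "(- 1) ^ degree q * (- 1) ^ (n + j) = (1 :: complex)"
    by (simp add: minus_one_power_iff flip: power_add)
  ultimately show ?thesis
    using pdet_eq_if_char_poly_factor[OF M cp[unfolded r_eq]] by (simp add: q0 mult.assoc[symmetric])
qed

subsection \<open>Existence and uniqueness of the pseudo-inverse\<close>

text \<open>Gaussian elimination, by induction on the number of non-zero rows.\<close>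

lemma ex_inner_inverse:
  fixes A :: "'a :: field mat"
  shows "\<exists>G\<in>carrier_mat (dim_col A) (dim_row A). A * G * A = A"
proof (induction "card {i. i < dim_row A \<and> (\<exists>j<dim_col A. A $$ (i, j) \<noteq> 0)}"
    arbitrary: A rule: less_induct)
  case less
  define n p where "n = dim_row A" and "p = dim_col A"
  note dims = n_def[symmetric] p_def[symmetric]
  show ?case
  proof (cases "\<exists>i<n. \<exists>j<p. A $$ (i, j) \<noteq> 0")
    case False
    then have "A = 0\<^sub>m n p" by (intro eq_matI) (auto simp: dims)
    then show ?thesis by (intro bexI[of _ "0\<^sub>m p n"]) auto
  next
    case True
    then obtain k l where kl: "k < n" "l < p" and a: "A $$ (k, l) \<noteq> 0" by auto
    \<comment> \<open>The inverse of the pivot at the transposed position: passing to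
      \<open>A - A * G * A\<close> subtracts multiples of row \<open>k\<close> so as to clear column
      \<open>l\<close>, and row \<open>k\<close> itself vanishes.\<close>
    define G where "G = mat p n (\<lambda>(j, i). if j = l \<and> i = k then inverse (A $$ (k, l)) else 0)"
    define L where "L = A - A * G * A"
    have G: "dim_row G = p" "dim_col G = n" by (auto simp: G_def)
    have L: "dim_row L = n" "dim_col L = p" by (auto simp: L_def dims)
    have AG: "(A * G) $$ (i, m) = (if m = k then A $$ (i, l) * inverse (A $$ (k, l)) else 0)"
      if "i < n" "m < n" for i m
      using that kl by (simp add: G_def dims scalar_prod_def if_distrib[of "(*) _"] sum.delta cong: if_cong)
    have AGA: "(A * G * A) $$ (i, j) = A $$ (i, l) * inverse (A $$ (k, l)) * A $$ (k, j)"
      if "i < n" "j < p" for i j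
    proof -
      have "(A * G * A) $$ (i, j) = (\<Sum>m<n. (A * G) $$ (i, m) * A $$ (m, j))"
        using that
        by (subst index_mult_mat(1)) (simp_all add: dims G scalar_prod_def lessThan_atLeast0
            del: index_mult_mat(1))
      also have "\<dots> = (\<Sum>m<n. if m = k
          then A $$ (i, l) * inverse (A $$ (k, l)) * A $$ (m, j) else 0)"
        using that by (intro sum.cong) (auto simp: AG)
      finally show ?thesis using kl by simp
    qed
    have L_ij: "L $$ (i, j) = A $$ (i, j) - A $$ (i, l) * inverse (A $$ (k, l)) * A $$ (k, j)"
      if "i < n" "j < p" for i j
      using that AGA[of i j] by (simp add: L_def dims G del: index_mult_mat(1))
    \<comment> \<open>A zero row \<open>i\<close> of \<open>A\<close> stays zero because its
      multiplier contains \<open>A $$ (i, l)\<close>; row \<open>k\<close> is newly zero.\<close>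
    have "{i. i < n \<and> (\<exists>j<p. L $$ (i, j) \<noteq> 0)} \<subset> {i. i < n \<and> (\<exists>j<p. A $$ (i, j) \<noteq> 0)}"
    proof
      show "{i. i < n \<and> (\<exists>j<p. L $$ (i, j) \<noteq> 0)} \<subseteq> {i. i < n \<and> (\<exists>j<p. A $$ (i, j) \<noteq> 0)}"
        using kl(2) by (auto simp: L_ij) (metis mult_zero_left diff_self)
      have "k \<in> {i. i < n \<and> (\<exists>j<p. A $$ (i, j) \<noteq> 0)}" using kl a by auto
      moreover have "k \<notin> {i. i < n \<and> (\<exists>j<p. L $$ (i, j) \<noteq> 0)}" using kl a by (auto simp: L_ij)
      ultimately show "{i. i < n \<and> (\<exists>j<p. L $$ (i, j) \<noteq> 0)} \<noteq> {i. i < n \<and> (\<exists>j<p. A $$ (i, j) \<noteq> 0)}"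
        by metis
    qed
    then have "card {i. i < n \<and> (\<exists>j<p. L $$ (i, j) \<noteq> 0)} < card {i. i < n \<and> (\<exists>j<p. A $$ (i, j) \<noteq> 0)}"
      by (intro psubset_card_mono) auto
    with less[of L] obtain H where H: "H \<in> carrier_mat p n" and LHL: "L * H * L = L"
      by (auto simp: L dims)
    note H = carrier_matD[OF H]
    let ?K = "G + (1\<^sub>m p - G * A) * H * (1\<^sub>m n - A * G)"
    \<comment> \<open>McCoy's identity: an inner inverse of \<open>A - A G A\<close> yields one of \<open>A\<close>; here the
      elimination by \<open>G\<close> has cleared row \<open>k\<close>.\<close>
    have "A * ?K * A = A * G * A + L * H * L"
      by (simp add: L_def mat_dim_simps dims G H)
    also have "\<dots> = A"
      unfolding LHL by (intro eq_matI) (auto simp: L_def dims simp del: index_mult_mat(1))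
    finally show ?thesis using G H by (intro bexI[of _ ?K]) (auto simp: dims)
  qed
qed

text \<open>If \<open>mat_adjoint A * A\<close> kills \<open>v\<close>, then the squared norm of
  \<open>A *\<^sub>v v\<close> is 0, so \<open>A\<close> kills \<open>v\<close> as well.\<close>

lemma mat_adjoint_mult_self_cancel:
  fixes A :: "complex mat"
  assumes "dim_row Z = dim_col A" "dim_row Z' = dim_col A" "dim_col Z = dim_col Z'"
    and eq: "mat_adjoint A * (A * Z) = mat_adjoint A * (A * Z')"
  shows "A * Z = A * Z'"
proof (rule mult_mat_cancel_if_kernel[of "mat_adjoint A * A" A])
  fix v assume v: "v \<in> carrier_vec (dim_col (mat_adjoint A * A))"
    and 0: "mat_adjoint A * A *\<^sub>v v = 0\<^sub>v (dim_row (mat_adjoint A * A))"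
  have "(A *\<^sub>v v) \<bullet>c (A *\<^sub>v v) = v \<bullet>c (mat_adjoint A *\<^sub>v (A *\<^sub>v v))"
    using v by (intro cscalar_prod_mult_mat_vec) (auto intro: carrier_vecI)
  also have "mat_adjoint A *\<^sub>v (A *\<^sub>v v) = 0\<^sub>v (dim_col A)"
    using 0 v by (simp add: mult_vec_assoc_dim)
  also have "v \<bullet>c 0\<^sub>v (dim_col A) = 0" using v by simp
  finally have "(A *\<^sub>v v) \<bullet>c (A *\<^sub>v v) = 0" .
  moreover have "A *\<^sub>v v \<in> carrier_vec (dim_row A)" by (rule carrier_vecI) simp
  ultimately show "A *\<^sub>v v = 0\<^sub>v (dim_row A)" by (simp only: conjugate_square_eq_0_vec)
qed (use assms in \<open>auto simp: mult_assoc_dim\<close>)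

text \<open>With \<open>G\<close> an inner inverse of \<open>mat_adjoint A * A\<close>, the product
  \<open>A * G * mat_adjoint A\<close> is the orthogonal projection onto the range of
  \<open>A\<close>.\<close>

lemma ex_hermitian_idempotent:
  fixes A :: "complex mat"
  shows "\<exists>G\<in>carrier_mat (dim_col A) (dim_col A).
    A * G * mat_adjoint A * A = A \<and> mat_adjoint (A * G * mat_adjoint A) = A * G * mat_adjoint A"
proof -
  obtain G where G: "G \<in> carrier_mat (dim_col A) (dim_col A)"
    and GG: "mat_adjoint A * A * G * (mat_adjoint A * A) = mat_adjoint A * A"
    using ex_inner_inverse[of "mat_adjoint A * A"] by auto
  note dims = carrier_matD[OF G]
  let ?P = "A * G * mat_adjoint A"
  have "A * (G * (mat_adjoint A * A)) = A * 1\<^sub>m (dim_col A)"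
    by (rule mat_adjoint_mult_self_cancel) (use GG in \<open>auto simp: mat_dim_simps dims\<close>)
  then have PA: "?P * A = A" by (simp add: mat_dim_simps dims)
  have adj: "mat_adjoint ?P = A * (mat_adjoint G * mat_adjoint A)"
    by (simp add: mat_adjoint_mult mat_dim_simps dims)
  \<comment> \<open>The adjoint of \<open>?P\<close> begins with \<open>A\<close>, which
    \<open>?P\<close> fixes. It therefore equals \<open>?P * mat_adjoint ?P\<close>, which is
    Hermitian, and so \<open>?P\<close> is Hermitian too.\<close>
  then have "?P * mat_adjoint ?P = ?P * A * (mat_adjoint G * mat_adjoint A)"
    by (simp add: mat_dim_simps dims)
  then have "?P * mat_adjoint ?P = mat_adjoint ?P" unfolding PA adj .
  moreover from this have "mat_adjoint (mat_adjoint ?P) = mat_adjoint (?P * mat_adjoint ?P)"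
    by (rule arg_cong[OF sym])
  moreover have "mat_adjoint (?P * mat_adjoint ?P) = mat_adjoint (mat_adjoint ?P) * mat_adjoint ?P"
    by (rule mat_adjoint_mult) simp
  ultimately have "mat_adjoint ?P = ?P" unfolding mat_adjoint_mat_adjoint by simp
  with PA G show ?thesis by blast
qed

text \<open>Penrose's argument: taking adjoints gives \<open>A * B = A * C\<close> and
  \<open>B * A = C * A\<close>, whence \<open>B = B * A * B = C * A * C = C\<close>.\<close>

lemma is_pinv_unique:
  assumes B: "is_pinv A B" and C: "is_pinv A C"
  shows "B = C"
proof -
  have dims: "dim_row B = dim_col A" "dim_col B = dim_row A"
    "dim_row C = dim_col A" "dim_col C = dim_row A"
    using B C by (auto simp: is_pinv_def)
  have b: "A * B * A = A" "B * A * B = B" "mat_adjoint (A * B) = A * B" "mat_adjoint (B * A) = B * A"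
    and c: "A * C * A = A" "C * A * C = C" "mat_adjoint (A * C) = A * C" "mat_adjoint (C * A) = C * A"
    using B C by (auto simp: is_pinv_def)
  have "A * B = (A * C * A) * B" by (simp only: c)
  also have "\<dots> = A * C * (A * B)" by (simp add: mat_dim_simps dims)
  also have "\<dots> = mat_adjoint (A * C) * mat_adjoint (A * B)" by (simp only: b c)
  also have "\<dots> = mat_adjoint (A * B * (A * C))"
    by (rule mat_adjoint_mult[symmetric]) (simp add: dims)
  also have "A * B * (A * C) = (A * B * A) * C" by (simp add: mat_dim_simps dims)
  finally have AB: "A * B = A * C" unfolding b c .
  have "B * A = B * (A * C * A)" by (simp only: c)
  also have "\<dots> = B * A * (C * A)" by (simp add: mat_dim_simps dims)
  also have "\<dots> = mat_adjoint (B * A) * mat_adjoint (C * A)" by (simp only: b c)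
  also have "\<dots> = mat_adjoint (C * A * (B * A))"
    by (rule mat_adjoint_mult[symmetric]) (simp add: dims)
  also have "C * A * (B * A) = C * (A * B * A)" by (simp add: mat_dim_simps dims)
  finally have BA: "B * A = C * A" unfolding b c .
  have "B = B * A * B" by (simp only: b)
  also have "\<dots> = C * (A * B)" unfolding BA by (simp add: mat_dim_simps dims)
  also have "\<dots> = C * A * C" unfolding AB by (simp add: mat_dim_simps dims)
  finally show ?thesis unfolding c .
qed

lemma is_pinv_pinv: "is_pinv A (pinv A)"
proof -
  obtain G where G: "G \<in> carrier_mat (dim_col A) (dim_col A)"
    and P: "A * G * mat_adjoint A * A = A"
      "mat_adjoint (A * G * mat_adjoint A) = A * G * mat_adjoint A"
    using ex_hermitian_idempotent[of A] by auto
  obtain H where H: "H \<in> carrier_mat (dim_row A) (dim_row A)"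
    and Q: "mat_adjoint A * H * A * mat_adjoint A = mat_adjoint A"
      "mat_adjoint (mat_adjoint A * H * A) = mat_adjoint A * H * A"
    using ex_hermitian_idempotent[of "mat_adjoint A"] by auto
  note dims = carrier_matD[OF G] carrier_matD[OF H]
  let ?Q = "mat_adjoint A * H * A"
  \<comment> \<open>\<open>G * mat_adjoint A\<close> is an inner inverse of \<open>A\<close> whose
    product with \<open>A\<close> on the left is Hermitian. The factor \<open>?Q\<close>, the
    orthogonal projection onto the range of the adjoint, makes the other product equal to
    \<open>?Q\<close> and keeps the first one.\<close>
  let ?B = "?Q * G * mat_adjoint A"
  have "mat_adjoint (?Q * mat_adjoint A) = A * ?Q"
    by (subst mat_adjoint_mult) (simp_all add: Q dims)
  then have AQ: "A * ?Q = A" unfolding Q by simp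
  have AB: "A * ?B = A * G * mat_adjoint A"
  proof -
    have "A * ?B = A * ?Q * G * mat_adjoint A" by (simp add: mat_dim_simps dims)
    then show ?thesis unfolding AQ .
  qed
  have BA: "?B * A = ?Q"
  proof -
    have "?B * A = mat_adjoint A * H * (A * G * mat_adjoint A * A)"
      by (simp add: mat_dim_simps dims)
    then show ?thesis unfolding P .
  qed
  have "A * ?B * A = A" unfolding AB P ..
  moreover have "?B * A * ?B = ?B"
  proof -
    have "?Q * ?B = mat_adjoint A * H * (A * ?Q) * G * mat_adjoint A"
      by (simp add: mat_dim_simps dims)
    then show ?thesis unfolding BA AQ .
  qed
  moreover have "mat_adjoint (A * ?B) = A * ?B" unfolding AB P ..
  moreover have "mat_adjoint (?B * A) = ?B * A" unfolding BA Q ..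
  ultimately have "is_pinv A ?B" unfolding is_pinv_def using dims by auto
  then show ?thesis unfolding pinv_def by (rule theI) (metis is_pinv_unique \<open>is_pinv A ?B\<close>)
qed

subsection \<open>Orthogonal complements, spectral idempotents and EP matrices\<close>

text \<open>Move \<open>Y\<close> across the inner product and test with
  \<open>mat_adjoint Y *\<^sub>v y\<close> itself. Orthogonal complements thereby become
  kernels.\<close>

lemma mat_kernel_mat_adjoint_eq_orth_compl:
  assumes Y: "Y \<in> carrier_mat n p"
  shows "orth_compl n (mat_image Y) = mat_kernel (mat_adjoint Y)"
proof -
  note dims = carrier_matD[OF Y]
  have *: "y \<bullet>c (Y *\<^sub>v u) = (mat_adjoint Y *\<^sub>v y) \<bullet>c u"
    if "y \<in> carrier_vec n" "u \<in> carrier_vec p" for y u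
    using that cscalar_prod_mult_mat_vec[of y "mat_adjoint Y" u] by (simp add: dims)
  have "(\<forall>u\<in>carrier_vec p. y \<bullet>c (Y *\<^sub>v u) = 0) \<longleftrightarrow> mat_adjoint Y *\<^sub>v y = 0\<^sub>v p"
    if y: "y \<in> carrier_vec n" for y
  proof
    have c: "mat_adjoint Y *\<^sub>v y \<in> carrier_vec p" by (rule carrier_vecI) (simp add: dims)
    assume "\<forall>u\<in>carrier_vec p. y \<bullet>c (Y *\<^sub>v u) = 0"
    with c y have "(mat_adjoint Y *\<^sub>v y) \<bullet>c (mat_adjoint Y *\<^sub>v y) = 0" by (simp add: *)
    with c show "mat_adjoint Y *\<^sub>v y = 0\<^sub>v p" by (simp only: conjugate_square_eq_0_vec)
  qed (use y in \<open>simp add: *\<close>)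
  then show ?thesis by (auto simp: orth_compl_def mat_image_def mat_kernel_def dims)
qed

lemma mat_adjoint_mult_vec_in_orth_compl_kernel:
  assumes V: "V \<in> carrier_mat n p" and w: "w \<in> carrier_vec n"
  shows "mat_adjoint V *\<^sub>v w \<in> orth_compl p (mat_kernel V)"
proof -
  note dims = carrier_matD[OF V]
  have "(mat_adjoint V *\<^sub>v w) \<bullet>c v = 0" if "v \<in> mat_kernel V" for v
  proof -
    from that have v: "v \<in> carrier_vec p" "V *\<^sub>v v = 0\<^sub>v n" by (auto simp: mat_kernel_def dims)
    with w cscalar_prod_mult_mat_vec[of w "mat_adjoint V" v] show ?thesis by (simp add: dims)
  qed
  moreover have "mat_adjoint V *\<^sub>v w \<in> carrier_vec p" by (rule carrier_vecI) (simp add: dims)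
  ultimately show ?thesis by (auto simp: orth_compl_def)
qed

lemma eq_mat_if_mult_vec_eq:
  fixes A B :: "'a :: semiring_1 mat"
  assumes A: "A \<in> carrier_mat n p" and B: "B \<in> carrier_mat n p"
    and eq: "\<And>v. v \<in> carrier_vec p \<Longrightarrow> A *\<^sub>v v = B *\<^sub>v v"
  shows "A = B"
proof (rule mat_col_eqI)
  fix j assume "j < dim_col B"
  with eq[of "unit_vec p j"] A B mult_unit_vec_eq_col[of j A] mult_unit_vec_eq_col[of j B]
  show "col A j = col B j" by auto
qed (use A B in auto)

lemma det_nonzero_if_kernel_trivial:
  fixes A :: "'a :: field mat"
  assumes A: "A \<in> carrier_mat n n"
    and "\<And>v. \<lbrakk>v \<in> carrier_vec n; A *\<^sub>v v = 0\<^sub>v n\<rbrakk> \<Longrightarrow> v = 0\<^sub>v n"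
  shows "det A \<noteq> 0"
  using assms(2) unfolding det_0_iff_vec_prod_zero_field[OF A] by auto

lemma ex_inverse_if_det_nonzero:
  fixes A :: "'a :: field mat"
  assumes A: "A \<in> carrier_mat n n" and det: "det A \<noteq> 0"
  shows "\<exists>B\<in>carrier_mat n n. A * B = 1\<^sub>m n \<and> B * A = 1\<^sub>m n"
proof (intro bexI conjI)
  let ?B = "inverse (det A) \<cdot>\<^sub>m adj_mat A"
  note adj = adj_mat[OF A]
  show B: "?B \<in> carrier_mat n n" using adj by auto
  show "A * ?B = 1\<^sub>m n" "?B * A = 1\<^sub>m n"
    using adj A det by (auto simp: smult_mult_dim intro!: eq_matI)
qed

text \<open>The kernel hypothesis says that \<open>R\<close> has index at most 1, so the space is
  the direct sum of its range and kernel; \<open>S\<close> is the projection onto the range along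
  the kernel.\<close>

lemma ex_spectral_idempotent:
  fixes R :: "'a :: field mat"
  assumes R: "R \<in> carrier_mat p p"
    and ker: "\<And>v. \<lbrakk>v \<in> carrier_vec p; R *\<^sub>v (R *\<^sub>v v) = 0\<^sub>v p\<rbrakk> \<Longrightarrow> R *\<^sub>v v = 0\<^sub>v p"
  shows "\<exists>S\<in>carrier_mat p p. S * S = S \<and> S * R = R \<and> R * S = R \<and> det (1\<^sub>m p - S + R) \<noteq> 0"
proof -
  obtain G where G: "G \<in> carrier_mat p p" and RGR: "R * G * R = R"
    using ex_inner_inverse[of R] R by auto
  note dims = carrier_matD[OF R] carrier_matD[OF G]
  \<comment> \<open>Chosen so that \<open>R * ?C = R * R\<close>. A vector killed by
    \<open>?C\<close> is killed by \<open>R * R\<close>, hence by \<open>R\<close>, hence is 0; the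
    inverse \<open>D\<close> then satisfies \<open>R * R * D = R\<close>.\<close>
  let ?C = "1\<^sub>m p - G * R + R"
  have C: "?C \<in> carrier_mat p p" using R G by auto
  have RC: "R * ?C = R * R"
    using RGR by (simp add: mat_dim_simps dims)
      (rule eq_matI; auto simp: dims simp del: index_mult_mat(1))
  have "det ?C \<noteq> 0"
  proof (rule det_nonzero_if_kernel_trivial[OF C])
    fix v :: "'a vec" assume v: "v \<in> carrier_vec p" and Cv: "?C *\<^sub>v v = 0\<^sub>v p"
    have "R *\<^sub>v (R *\<^sub>v v) = R * ?C *\<^sub>v v"
      unfolding RC using v by (simp add: mult_vec_assoc_dim dims)
    also have "\<dots> = 0\<^sub>v p" using v R C by (subst assoc_mult_mat_vec[OF R C]) (auto simp: Cv)
    finally have Rv: "R *\<^sub>v v = 0\<^sub>v p" using ker v by auto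
    have "?C *\<^sub>v v = v - G *\<^sub>v (R *\<^sub>v v) + R *\<^sub>v v"
      using v by (simp add: mult_vec_dim_simps dims)
    with Cv Rv v show "v = 0\<^sub>v p" by (simp add: mult_vec_dim_simps dims)
  qed
  then obtain D where D: "D \<in> carrier_mat p p" and CD: "?C * D = 1\<^sub>m p"
    using ex_inverse_if_det_nonzero[OF C] by auto
  note dims = dims carrier_matD[OF D]
  have "R * (R * D) = (R * ?C) * D" unfolding RC by (simp add: mult_assoc_dim dims)
  also have "\<dots> = R * (?C * D)" by (rule assoc_mult_mat[OF R C D])
  finally have RRD: "R * (R * D) = R" unfolding CD using R by simp
  \<comment> \<open>Both sides agree after multiplication by \<open>R\<close>, which cancels because
    \<open>R * R\<close> and \<open>R\<close> have the same kernel.\<close>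
  have "R * (D * R) = R * 1\<^sub>m p"
  proof (rule mult_mat_cancel_if_kernel[of "R * R" R])
    have "R * R * (D * R) = R * (R * D) * R" by (simp add: mult_assoc_dim dims)
    then show "R * R * (D * R) = R * R * 1\<^sub>m p" unfolding RRD using R by simp
    show "R *\<^sub>v v = 0\<^sub>v (dim_row R)"
      if "v \<in> carrier_vec (dim_col (R * R))" "R * R *\<^sub>v v = 0\<^sub>v (dim_row (R * R))" for v
      using that ker by (simp add: mult_vec_assoc_dim dims)
  qed (auto simp: dims)
  then have RDR: "R * D * R = R" using R by (simp add: mult_assoc_dim dims)
  define S where "S = R * D"
  have S: "S \<in> carrier_mat p p" using R D by (simp add: S_def)
  note dims = dims carrier_matD[OF S]
  have SR: "S * R = R" and RS: "R * S = R" unfolding S_def by (rule RDR, rule RRD)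
  have "S * S = S * R * D" by (simp add: S_def mult_assoc_dim dims)
  then have SS: "S * S = S" by (simp only: SR flip: S_def)
  let ?J = "1\<^sub>m p - S + R"
  have J: "?J \<in> carrier_mat p p" using R S by auto
  have RJ: "R * ?J = R * R"
    using RS by (simp add: mat_dim_simps dims)
      (rule eq_matI; auto simp: dims simp del: index_mult_mat(1))
  have "det ?J \<noteq> 0"
  proof (rule det_nonzero_if_kernel_trivial[OF J])
    fix v :: "'a vec" assume v: "v \<in> carrier_vec p" and Jv: "?J *\<^sub>v v = 0\<^sub>v p"
    have "R *\<^sub>v (R *\<^sub>v v) = R * ?J *\<^sub>v v"
      unfolding RJ using v by (simp add: mult_vec_assoc_dim dims)
    also have "\<dots> = 0\<^sub>v p" using v R J by (subst assoc_mult_mat_vec[OF R J]) (auto simp: Jv)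
    finally have Rv: "R *\<^sub>v v = 0\<^sub>v p" using ker v by auto
    have Dv: "D *\<^sub>v v \<in> carrier_vec p" by (rule carrier_vecI) (simp add: dims)
    have "R *\<^sub>v (R *\<^sub>v (D *\<^sub>v v)) = R * (R * D) *\<^sub>v v"
      using v by (simp add: mult_vec_assoc_dim dims)
    with Rv RRD have "R *\<^sub>v (D *\<^sub>v v) = 0\<^sub>v p" using ker Dv by auto
    then have Sv: "S *\<^sub>v v = 0\<^sub>v p" using v by (simp add: S_def mult_vec_assoc_dim dims)
    have "?J *\<^sub>v v = v - S *\<^sub>v v + R *\<^sub>v v"
      using v by (simp add: mult_vec_dim_simps dims)
    with Jv Rv Sv v show "v = 0\<^sub>v p" by simp
  qed
  with S SS SR RS show ?thesis by blast
qed

text \<open>Equality of the ranges factors \<open>A\<close> and its adjoint through each other. So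
  \<open>A * pinv A\<close> fixes the adjoint and \<open>pinv A * A\<close> fixes \<open>A\<close>;
  inserting both facts in \<open>pinv A * A * A * pinv A\<close> gives the claim.\<close>

lemma pinv_commute_if_EP_mat:
  assumes "EP_mat A"
  shows "pinv A * A = A * pinv A"
proof -
  from assms have img: "mat_image A = mat_image (mat_adjoint A)" and sq: "dim_row A = dim_col A"
    by (auto simp: EP_mat_def)
  have pd: "dim_row (pinv A) = dim_col A" "dim_col (pinv A) = dim_row A"
    and p: "A * pinv A * A = A" "pinv A * A * pinv A = pinv A"
      "mat_adjoint (A * pinv A) = A * pinv A" "mat_adjoint (pinv A * A) = pinv A * A"
    using is_pinv_pinv[of A] by (auto simp: is_pinv_def)
  note dims = sq pd
  have "\<exists>F\<in>carrier_mat (dim_col A) (dim_row A). mat_adjoint A = A * F"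
    by (rule mat_factor_if_image_subset[where n = "dim_row A"])
      (auto simp: sq img intro: carrier_matI, simp add: mat_image_def sq)
  then obtain F where F: "F \<in> carrier_mat (dim_col A) (dim_row A)" "mat_adjoint A = A * F"
    by blast
  have "\<exists>F\<in>carrier_mat (dim_row A) (dim_col A). A = mat_adjoint A * F"
    by (rule mat_factor_if_image_subset[where n = "dim_row A"])
      (auto simp: sq img[symmetric] intro: carrier_matI, simp add: mat_image_def sq)
  then obtain F' where F': "F' \<in> carrier_mat (dim_row A) (dim_col A)" "A = mat_adjoint A * F'"
    by blast
  note dims = dims carrier_matD[OF F(1)] carrier_matD[OF F'(1)]
  have "A * pinv A * mat_adjoint A = A * pinv A * A * F"
    unfolding F(2) by (simp add: mult_assoc_dim dims)
  then have "A * pinv A * mat_adjoint A = mat_adjoint A" unfolding p F(2)[symmetric] .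
  then have "mat_adjoint (A * pinv A * mat_adjoint A) = A" by simp
  then have 1: "A * (A * pinv A) = A"
    by (subst (asm) mat_adjoint_mult) (simp_all add: p dims)
  have "mat_adjoint (A * (pinv A * A)) = pinv A * A * mat_adjoint A"
    by (subst mat_adjoint_mult) (simp_all add: p dims)
  moreover have "A * (pinv A * A) = A" using p(1) by (simp add: mult_assoc_dim dims)
  ultimately have "pinv A * A * mat_adjoint A = mat_adjoint A" by simp
  then have "pinv A * A * mat_adjoint A * F' = A" using F'(2) by simp
  then have 2: "pinv A * A * A = A" 
    using F'(2) by (simp add: mult_assoc_dim dims)
  have "pinv A * A = pinv A * (A * (A * pinv A))" unfolding 1 ..
  also have "\<dots> = pinv A * A * A * pinv A" by (simp add: mult_assoc_dim dims)
  also have "\<dots> = A * pinv A" unfolding 2 ..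
  finally show ?thesis .
qed

theorem mainTheorem6:
  fixes n p :: nat and A X Y PA P N :: "complex mat"
  assumes A: "A \<in> carrier_mat n n" and EP: "EP_mat A"
    and X: "X \<in> carrier_mat n p" and Y: "Y \<in> carrier_mat n p"
    and PA: "PA = A * pinv A"
    and P: "P = 1\<^sub>m n - X * pinv (mat_adjoint Y * X) * mat_adjoint Y"
    and N: "N = 1\<^sub>m n - P + A * P"
    and sum1: "direct_sum_eq_space n (mat_image X)
                 ((\<lambda>v. A *\<^sub>v v) ` orth_compl n (mat_image Y))"
    and sum2: "direct_sum_eq_space n (mat_image X) (orth_compl n (mat_image Y))"
    and incl: "orth_compl n (mat_image A) \<subseteq> mat_image X \<inter> mat_image Y"
    and ker: "mat_kernel (PA * X) \<inter> orth_compl p (mat_kernel (PA * Y)) = {0\<^sub>v p}"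
  shows "invertible_mat N \<and>
    pdet A * pdet (mat_adjoint Y * pinv A * X)
      = pdet (mat_adjoint Y * A * pinv A * X) * det N"
proof -

  \<comment> \<open>Relations between \<open>A\<close>, its pseudo-inverse and
    \<open>PA\<close>\<close>
  define Ai Yh V W Wi Q E where "Ai = pinv A" and "Yh = mat_adjoint Y" and "V = Yh * PA"
    and "W = Yh * X" and "Wi = pinv W" and "Q = X * Wi * Yh" and "E = 1\<^sub>m n - PA"
  have dAX: "dim_row A = n" "dim_col A = n" "dim_row X = n" "dim_col X = p" "dim_row Y = n" "dim_col Y = p"
    using A X Y by auto
  have dY: "dim_row Yh = p" "dim_col Yh = n" by (auto simp: Yh_def dAX)
  have dW: "dim_row W = p" "dim_col W = p" by (auto simp: W_def dAX dY)
  have Ai: "dim_row Ai = n" "dim_col Ai = n" "A * Ai * A = A" "Ai * A * Ai = Ai"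
    "mat_adjoint (A * Ai) = A * Ai"
    using is_pinv_pinv[of A] by (auto simp: is_pinv_def Ai_def dAX)
  have Wi: "dim_row Wi = p" "dim_col Wi = p" "W * Wi * W = W"
    using is_pinv_pinv[of W] by (auto simp: is_pinv_def Wi_def dW)
  have AAi: "A * Ai = PA" by (simp add: PA Ai_def)
  have AiA: "Ai * A = PA" using pinv_commute_if_EP_mat[OF EP] by (simp add: PA Ai_def)
  have dPA: "dim_row PA = n" "dim_col PA = n" unfolding AAi[symmetric] by (auto simp: dAX Ai)
  note dims = dAX dY dW Ai(1,2) Wi(1,2) dPA
  have PA_A: "PA * A = A" using Ai by (simp add: AAi)
  have A_PA: "A * PA = A" using Ai by (simp add: mult_assoc_dim dims flip: AiA)
  have PA_Ai: "PA * Ai = Ai" using Ai by (simp flip: AiA)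
  have Ai_PA: "Ai * PA = Ai" using Ai by (simp add: mult_assoc_dim dims flip: AAi)
  have PA_adj: "mat_adjoint PA = PA" using Ai by (simp add: AAi)
  have PA_PA: "PA * PA = PA"
  proof -
    have "PA * PA = PA * A * Ai" by (simp add: mult_assoc_dim dims flip: AAi)
    then show ?thesis by (simp only: PA_A AAi)
  qed
  have dV: "dim_row V = p" "dim_col V = n" by (auto simp: V_def dims)
  have dQ: "dim_row Q = n" "dim_col Q = n" by (auto simp: Q_def dims)
  have dE: "dim_row E = n" "dim_col E = n" by (auto simp: E_def dims)
  note dims = dims dV dQ dE
  have P: "P = 1\<^sub>m n - Q" unfolding P Q_def Wi_def W_def Yh_def ..
  have dP: "dim_row P = n" "dim_col P = n" by (auto simp: P dims)
  have N: "N = Q + A * P" unfolding N P by (rule eq_matI) (auto simp: dims simp del: index_mult_mat(1))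
  have dN: "dim_row N = n" "dim_col N = n" by (auto simp: N dims dP)
  note dims = dims dP dN

  \<comment> \<open>The oblique projection \<open>Q\<close>\<close>
  have Yperp: "orth_compl n (mat_image Y) = mat_kernel Yh"
    unfolding Yh_def by (rule mat_kernel_mat_adjoint_eq_orth_compl[OF Y])
  have img_X: "mat_image X = {X *\<^sub>v u | u. u \<in> carrier_vec p}" by (auto simp: mat_image_def dims)
  have QX: "Q * X = X"
  proof -
    \<comment> \<open>If \<open>W\<close> kills \<open>v\<close>, then \<open>X *\<^sub>v v\<close>
      lies in both summands of the second direct sum and is 0; so \<open>W * Wi * W = W\<close>
      passes to \<open>X\<close>.\<close>
    have "X * (Wi * W) = X * 1\<^sub>m p"
    proof (rule mult_mat_cancel_if_kernel[of W])
      fix v assume v: "v \<in> carrier_vec (dim_col W)" and Wv: "W *\<^sub>v v = 0\<^sub>v (dim_row W)"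
      have "X *\<^sub>v v \<in> mat_image X" using v by (auto simp: img_X dims)
      moreover have "X *\<^sub>v v \<in> mat_kernel Yh"
        using Wv v by (auto simp: mat_kernel_def W_def mult_vec_dim_simps dims intro!: carrier_vecI)
      ultimately show "X *\<^sub>v v = 0\<^sub>v (dim_row X)"
        using sum2 unfolding Yperp direct_sum_eq_space_def dims by blast
    next
      show "W * (Wi * W) = W * 1\<^sub>m p" using Wi(3) by (simp add: mat_dim_simps dims)
    qed (auto simp: dims)
    then show ?thesis by (simp add: Q_def W_def mat_dim_simps dims)
  qed
  have Q_ker: "Q *\<^sub>v y = 0\<^sub>v n" if "y \<in> mat_kernel Yh" for y
    using that by (auto simp: mat_kernel_def Q_def mult_vec_dim_simps dims)
  \<comment> \<open>Checked on the two summands: \<open>Q\<close> fixes the range of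
    \<open>X\<close>, and both sides vanish on the kernel of \<open>Yh\<close>.\<close>
  have YQ: "Yh * Q = Yh"
  proof (rule eq_mat_if_mult_vec_eq)
    fix v :: "complex vec" assume "v \<in> carrier_vec n"
    with sum2 have "v \<in> {u + v | u v. u \<in> mat_image X \<and> v \<in> mat_kernel Yh}"
      unfolding Yperp direct_sum_eq_space_def by blast
    then obtain u y where u: "u \<in> carrier_vec p" and y: "y \<in> mat_kernel Yh" and v: "v = X *\<^sub>v u + y"
      unfolding img_X by blast
    have c: "X *\<^sub>v u \<in> carrier_vec n" "y \<in> carrier_vec n"
      using y by (auto simp: mat_kernel_def dims intro: carrier_vecI)
    have dist: "B *\<^sub>v v = B *\<^sub>v (X *\<^sub>v u) + B *\<^sub>v y" if "dim_col B = n" for B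
      unfolding v using that c by (intro mult_add_distrib_mat_vec) auto
    have "Q *\<^sub>v (X *\<^sub>v u) = (Q * X) *\<^sub>v u" using u by (simp add: mult_vec_dim_simps dims)
    then have "Yh * Q *\<^sub>v (X *\<^sub>v u) = Yh *\<^sub>v (X *\<^sub>v u)"
      using u unfolding QX by (simp add: mult_vec_dim_simps dims)
    moreover have "Yh * Q *\<^sub>v y = Yh *\<^sub>v y"
      using y c Q_ker[OF y] by (auto simp: mult_vec_dim_simps dims mat_kernel_def)
    ultimately show "Yh * Q *\<^sub>v v = Yh *\<^sub>v v" by (simp add: dist dims)
  qed (auto simp: dims intro!: carrier_matI)

  \<comment> \<open>Commutation of \<open>Q\<close> with \<open>PA\<close>\<close>
  have EE: "mat_adjoint E = E" unfolding E_def by (simp add: mat_adjoint_minus dims PA_adj)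
  have EA: "E * A = 0\<^sub>m n n" by (simp add: E_def mat_dim_simps dims PA_A)
  have AiE: "Ai * E = 0\<^sub>m n n" by (simp add: E_def mat_dim_simps dims Ai_PA)
  have E_mem: "E *\<^sub>v v \<in> mat_image X \<inter> mat_image Y" if "v \<in> carrier_vec n" for v
  proof -
    have "mat_adjoint A * E = mat_adjoint (E * A)"
      by (simp add: mat_adjoint_mult dims EE)
    also have "\<dots> = 0\<^sub>m n n" unfolding EA by (rule eq_matI) auto
    finally have "mat_adjoint A *\<^sub>v (E *\<^sub>v v) = 0\<^sub>m n n *\<^sub>v v"
      using that by (simp add: dims flip: mult_vec_assoc_dim)
    then have "E *\<^sub>v v \<in> mat_kernel (mat_adjoint A)"
      using that by (auto simp: mat_kernel_def dims intro!: carrier_vecI)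
    then show ?thesis using incl mat_kernel_mat_adjoint_eq_orth_compl[OF A] by auto
  qed
  have cE: "E \<in> carrier_mat n n" by (auto simp: dims intro: carrier_matI)
  \<comment> \<open>The inclusion hypothesis in matrix form. \<open>Q * X = X\<close> then gives
    \<open>Q * E = E\<close>, and \<open>Yh * Q = Yh\<close> gives \<open>E * Q = E\<close> because
    \<open>E\<close> is Hermitian.\<close>
  obtain F where F: "F \<in> carrier_mat p n" "E = X * F"
    using mat_factor_if_image_subset[OF cE X] E_mem by blast
  obtain F' where F': "F' \<in> carrier_mat p n" "E = Y * F'"
    using mat_factor_if_image_subset[OF cE Y] E_mem by blast
  have QE: "Q * E = E"
  proof -
    have "Q * E = Q * X * F" unfolding F(2) using F(1) by (simp add: mult_assoc_dim dims)
    then show ?thesis unfolding QX F(2) .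
  qed
  have EQ: "E * Q = E"
  proof -
    have E: "E = mat_adjoint F' * Yh"
      using F'(1) EE unfolding F'(2) by (simp add: mat_adjoint_mult dims Yh_def)
    have "E * Q = mat_adjoint F' * (Yh * Q)"
      unfolding E using F'(1) by (simp add: mult_assoc_dim dims)
    then show ?thesis unfolding YQ E .
  qed
  have PA_E: "PA = 1\<^sub>m n - E" by (rule eq_matI) (auto simp: E_def dims)
  have PAQ: "PA * Q = Q - E" and QPA: "Q * PA = Q - E"
    by (simp_all add: PA_E mat_dim_simps dims EQ QE)

  \<comment> \<open>The matrices \<open>R\<close> and \<open>M\<close> under the two outer
    pseudo-determinants\<close>
  define U D where "U = PA * X" and "D = Ai - 1\<^sub>m n"
  define R M where "R = V * U" and "M = V * Ai * U"
  have dU: "dim_row U = n" "dim_col U = p" by (auto simp: U_def dims)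
  have dD: "dim_row D = n" "dim_col D = n" by (auto simp: D_def dims)
  have dR: "dim_row R = p" "dim_col R = p" "dim_row M = p" "dim_col M = p"
    by (auto simp: R_def M_def dims dU)
  note dims = dims dU dD dR
  have Q': "U * Wi * V = PA * Q"
  proof -
    have "U * Wi * V = PA * (Q * PA)" by (simp add: U_def V_def Q_def mult_assoc_dim dims)
    also have "\<dots> = PA * PA * Q" unfolding QPA PAQ[symmetric] by (simp add: mult_assoc_dim dims)
    finally show ?thesis unfolding PA_PA .
  qed
  \<comment> \<open>With \<open>RWiV\<close> below, this shows that \<open>R = V * U\<close> has the
    kernel of \<open>U\<close> and the range of \<open>V\<close>.\<close>
  have UWiR: "U * Wi * R = U"
  proof -
    have "U * Wi * R = U * Wi * V * U" by (simp add: R_def mult_assoc_dim dims)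
    also have "\<dots> = PA * (Q * PA) * X" unfolding Q' by (simp add: U_def mult_assoc_dim dims)
    also have "\<dots> = PA * PA * (Q * X)" unfolding QPA PAQ[symmetric] by (simp add: mult_assoc_dim dims)
    finally show ?thesis unfolding QX PA_PA U_def .
  qed
  have RWiV: "R * Wi * V = V"
  proof -
    have "R * Wi * V = V * (U * Wi * V)" by (simp add: R_def mult_assoc_dim dims)
    also have "\<dots> = Yh * (PA * PA * Q)" unfolding Q' by (simp add: V_def mult_assoc_dim dims)
    also have "\<dots> = Yh * Q * PA" unfolding PA_PA PAQ QPA[symmetric] by (simp add: mult_assoc_dim dims)
    finally show ?thesis unfolding YQ V_def .
  qed

  \<comment> \<open>A common idempotent for \<open>R\<close> and \<open>M\<close>\<close>
  have PAY: "PA * Y \<in> carrier_mat n p" by (auto simp: dims intro: carrier_matI)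
  have V_adj: "V = mat_adjoint (PA * Y)" by (simp add: mat_adjoint_mult V_def Yh_def PA_adj dims)
  have cR: "R \<in> carrier_mat p p" by (auto simp: dims intro: carrier_matI)
  \<comment> \<open>\<open>R *\<^sub>v v\<close> lies in the kernel of \<open>U\<close> by
    \<open>UWiR\<close>, and in the range of the adjoint of \<open>PA * Y\<close>, hence orthogonal
    to the kernel of \<open>PA * Y\<close>. The kernel condition forces it to be 0.\<close>
  have "R *\<^sub>v v = 0\<^sub>v p" if v: "v \<in> carrier_vec p" and RRv: "R *\<^sub>v (R *\<^sub>v v) = 0\<^sub>v p" for v
  proof -
    have dv: "dim_vec v = p" using v by simp
    have "U *\<^sub>v (R *\<^sub>v v) = U * Wi * R *\<^sub>v (R *\<^sub>v v)" by (simp only: UWiR)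
    also have "\<dots> = 0\<^sub>v n" using RRv by (simp add: mult_vec_dim_simps dims dv)
    finally have "R *\<^sub>v v \<in> mat_kernel (PA * X)"
      unfolding U_def[symmetric] by (auto simp: mat_kernel_def dims intro!: carrier_vecI)
    moreover have "R *\<^sub>v v = V *\<^sub>v (U *\<^sub>v v)" by (simp add: R_def mult_vec_dim_simps dims dv)
    then have "R *\<^sub>v v \<in> orth_compl p (mat_kernel (PA * Y))"
      unfolding V_adj
      using mat_adjoint_mult_vec_in_orth_compl_kernel[OF PAY, of "U *\<^sub>v v"]
      by (simp add: carrier_dim_vec dims)
    ultimately show ?thesis using ker by blast
  qed
  from ex_spectral_idempotent[OF cR this] obtain S where S: "S \<in> carrier_mat p p"
    and SS: "S * S = S" and SR: "S * R = R" and RS: "R * S = R"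
    and detJ: "det (1\<^sub>m p - S + R) \<noteq> 0" by blast
  note dims = dims carrier_matD[OF S]
  have US: "U * S = U"
  proof -
    have "U * Wi * R * S = U * Wi * (R * S)" by (simp add: mult_assoc_dim dims)
    then show ?thesis unfolding RS UWiR .
  qed
  have SV: "S * V = V"
  proof -
    have "S * (R * Wi * V) = S * R * Wi * V" by (simp add: mult_assoc_dim dims)
    then show ?thesis unfolding SR RWiV .
  qed
  have SM: "S * M = M"
  proof -
    have "S * M = S * V * Ai * U" by (simp add: M_def mult_assoc_dim dims)
    then show ?thesis unfolding SV M_def .
  qed
  have MS: "M * S = M" by (simp add: M_def mult_assoc_dim dims US)

  \<comment> \<open>Comparison of the determinants of \<open>R\<close> and \<open>M\<close>\<close>
  define J where "J = 1\<^sub>m p - S + R"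
  have J: "J \<in> carrier_mat p p" using S cR by (simp add: J_def)
  obtain Ji where Ji: "Ji \<in> carrier_mat p p" and JJi: "J * Ji = 1\<^sub>m p" and JiJ: "Ji * J = 1\<^sub>m p"
    using ex_inverse_if_det_nonzero[OF J] detJ by (auto simp: J_def)
  note dims = dims carrier_matD[OF J] carrier_matD[OF Ji]
  have JS: "J * S = R"
    by (simp add: J_def mat_dim_simps dims SS RS)
      (rule eq_matI; auto simp: dims simp del: index_mult_mat(1))
  have JiR: "Ji * R = S"
  proof -
    have "Ji * (J * S) = Ji * J * S" by (simp add: mult_assoc_dim dims)
    then show ?thesis unfolding JS JiJ using S by simp
  qed
  \<comment> \<open>Writing \<open>V\<close> as \<open>R * Wi * V\<close> exposes
    \<open>Ji * R = S\<close>, which \<open>U\<close> absorbs; \<open>Ji\<close> may thus be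
    replaced by \<open>Wi\<close>.\<close>
  have UJiV: "U * (Ji * V) = PA * Q"
  proof -
    have "U * (Ji * (R * Wi * V)) = U * (Ji * R) * Wi * V" by (simp add: mult_assoc_dim dims)
    then show ?thesis unfolding RWiV JiR US Q' .
  qed
  \<comment> \<open>The left side is \<open>J + (M - R)\<close>, and
    \<open>M - R = V * D * U\<close>.\<close>
  have J_fac: "1\<^sub>m p - S + M = J * (1\<^sub>m p + (Ji * V) * (D * U))"
  proof -
    have "V * D * U = M - R" by (simp add: D_def M_def R_def mat_dim_simps dims)
    moreover have "J * ((Ji * V) * (D * U)) = J * Ji * (V * D * U)" by (simp add: mult_assoc_dim dims)
    ultimately have "J * ((Ji * V) * (D * U)) = M - R" by (simp add: JJi one_mult_dim dims)
    then have "J * (1\<^sub>m p + (Ji * V) * (D * U)) = J + (M - R)"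
      by (simp add: mult_add_distrib_dim mult_one_dim dims)
    also have "\<dots> = 1\<^sub>m p - S + M"
      unfolding J_def by (rule eq_matI) (auto simp: dims)
    finally show ?thesis ..
  qed
  let ?d = "det (1\<^sub>m n + D * (PA * Q))"
  have det_M: "det (1\<^sub>m p - S + M) = det J * ?d"
  proof -
    have "det (1\<^sub>m p + (Ji * V) * (D * U)) = det (1\<^sub>m n + (D * U) * (Ji * V))"
      by (rule det_one_plus_mult_commute) (auto simp: dims intro: carrier_matI)
    also have "(D * U) * (Ji * V) = D * (U * (Ji * V))" by (simp add: mult_assoc_dim dims)
    finally show ?thesis unfolding J_fac UJiV
      by (subst det_mult[OF J]) (auto simp: dims intro!: carrier_matI)
  qed

  \<comment> \<open>Comparison of the determinants of \<open>N\<close> and \<open>A\<close>\<close>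
  \<comment> \<open>\<open>B\<close> is \<open>A\<close> made invertible by the identity on the
    complement of its range; its determinant is \<open>pdet A\<close>.\<close>
  define B Bi where "B = E + A" and "Bi = E + Ai"
  have cN: "N \<in> carrier_mat n n" and cB: "B \<in> carrier_mat n n" and cBi: "Bi \<in> carrier_mat n n"
    by (auto simp: B_def Bi_def dims intro: carrier_matI)
  have E_E: "E * E = E"
    by (simp add: E_def mat_dim_simps dims PA_PA) (rule eq_matI; auto simp: dims)
  have "Bi * B = 1\<^sub>m n"
    by (simp add: B_def Bi_def mat_dim_simps dims E_E EA AiE AiA)
      (rule eq_matI; auto simp: dims E_def)
  then have det_B: "det Bi * det B = 1" using det_mult[OF cBi cB] by simp
  have "Bi * N = 1\<^sub>m n + D * (PA * Q)"
  proof -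
    have "Bi * N = (E * Q + E * A * P) + (Ai * Q + Ai * A * P)"
      by (simp add: Bi_def N mat_dim_simps dims)
        (rule eq_matI; auto simp: dims simp del: index_mult_mat(1))
    also have "E * A * P = 0\<^sub>m n n"
      unfolding EA by (rule left_mult_zero_mat) (auto simp: dims intro: carrier_matI)
    also have "E * Q + 0\<^sub>m n n = E" unfolding EQ using cE by simp
    also have "Ai * A * P = PA - PA * Q" unfolding AiA by (simp add: P mat_dim_simps dims)
    also have "E + (Ai * Q + (PA - PA * Q)) = 1\<^sub>m n + (Ai * PA * Q - PA * Q)"
      unfolding Ai_PA by (rule eq_matI) (auto simp: dims E_def simp del: index_mult_mat(1))
    also have "Ai * PA * Q - PA * Q = D * (PA * Q)" by (simp add: D_def mat_dim_simps dims)
    finally show ?thesis .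
  qed
  then have det_N: "det Bi * det N = ?d" using det_mult[OF cBi cN] by simp

  \<comment> \<open>Non-singularity of \<open>N\<close>\<close>
  \<comment> \<open>\<open>N\<close> fixes the range of \<open>X\<close> and acts as
    \<open>A\<close> on the kernel of \<open>Yh\<close>, so its range contains both summands of the
    first direct sum.\<close>
  have "\<exists>K\<in>carrier_mat n n. 1\<^sub>m n = N * K"
  proof (rule mat_factor_if_image_subset[OF one_carrier_mat cN])
    fix v :: "complex vec" assume v: "v \<in> carrier_vec n"
    with sum1 have "v \<in> {u + v | u v. u \<in> mat_image X \<and> v \<in> (\<lambda>v. A *\<^sub>v v) ` mat_kernel Yh}"
      unfolding Yperp direct_sum_eq_space_def by blast
    then obtain u y where u: "u \<in> carrier_vec p" and y: "y \<in> mat_kernel Yh"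
      and v_eq: "v = X *\<^sub>v u + A *\<^sub>v y"
      unfolding img_X by blast
    have dy: "dim_vec y = n" using y by (auto simp: mat_kernel_def dims)
    have c: "X *\<^sub>v u \<in> carrier_vec n" "y \<in> carrier_vec n"
      using dy by (auto simp: dims intro: carrier_vecI)
    have NX: "N * X = X"
    proof -
      have "P * X = 0\<^sub>m n p" by (simp add: P mat_dim_simps dims QX)
      then show ?thesis
        using X by (simp add: N mat_dim_simps dims QX)
    qed
    have "N *\<^sub>v (X *\<^sub>v u) = N * X *\<^sub>v u" using u by (simp add: mult_vec_dim_simps dims)
    then have 1: "N *\<^sub>v (X *\<^sub>v u) = X *\<^sub>v u" unfolding NX .
    have "P *\<^sub>v y = y" using c by (simp add: P mult_vec_dim_simps dims dy Q_ker[OF y])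
    then have 2: "N *\<^sub>v y = A *\<^sub>v y"
      by (simp add: N mult_vec_dim_simps dims dy Q_ker[OF y]) (auto simp: dims)
    have "N *\<^sub>v (X *\<^sub>v u + y) = v"
      unfolding v_eq using c by (subst mult_add_distrib_mat_vec[OF cN]) (auto simp: 1 2)
    moreover have "X *\<^sub>v u + y \<in> carrier_vec n" using c by simp
    ultimately show "1\<^sub>m n *\<^sub>v v \<in> mat_image N" using v by (auto simp: mat_image_def dims)
  qed
  then obtain K where K: "K \<in> carrier_mat n n" and NK: "N * K = 1\<^sub>m n" by metis
  then have KN: "K * N = 1\<^sub>m n" using mat_mult_left_right_inverse[OF cN K] by simp
  have inv_N: "invertible_mat N"
    using NK KN K by (auto simp: invertible_mat_def inverts_mat_def dims)

  \<comment> \<open>Evaluation of the pseudo-determinants\<close>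
  have "det N \<noteq> 0" using NK det_mult[OF cN K] by auto
  \<comment> \<open>This supplies the non-singularity premise under which \<open>pdet M\<close> is a
    determinant.\<close>
  then have "?d \<noteq> 0" using det_N det_B by auto
  moreover have "M \<in> carrier_mat p p" by (rule carrier_matI) (simp_all add: dims)
  ultimately have pdet_M: "pdet M = det J * ?d"
    using pdet_eq_det_if_idempotent[OF S _ SS SM MS] detJ det_M by (simp add: J_def)
  have pdet_R: "pdet R = det J"
    using pdet_eq_det_if_idempotent[OF S cR SS SR RS detJ] by (simp add: J_def)
  have pdet_A: "pdet A = det B"
  proof -
    have "1\<^sub>m n - PA + A = B" by (simp add: B_def E_def)
    moreover have "det B \<noteq> 0" using det_B by auto
    moreover have "PA \<in> carrier_mat n n" by (rule carrier_matI) (simp_all add: dims)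
    ultimately show ?thesis using pdet_eq_det_if_idempotent[OF _ A PA_PA PA_A A_PA] by simp
  qed
  have R_eq: "mat_adjoint Y * A * pinv A * X = R"
  proof -
    have "Yh * A * Ai * X = Yh * (A * Ai) * X" by (simp add: mult_assoc_dim dims)
    also have "\<dots> = Yh * (PA * PA) * X" unfolding AAi PA_PA ..
    also have "\<dots> = R" by (simp add: R_def V_def U_def mult_assoc_dim dims)
    finally show ?thesis unfolding Yh_def Ai_def .
  qed
  have M_eq: "mat_adjoint Y * pinv A * X = M"
  proof -
    have "M = Yh * (PA * Ai * PA) * X" by (simp add: M_def V_def U_def mult_assoc_dim dims)
    then show ?thesis by (simp only: PA_Ai Ai_PA flip: Yh_def Ai_def)
  qed
  have "pdet A * pdet M = pdet R * (det B * ?d)" by (simp add: pdet_A pdet_M pdet_R)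
  also have "det B * ?d = (det Bi * det B) * det N" by (simp add: det_N[symmetric])
  finally have "pdet A * pdet M = pdet R * det N" by (simp add: det_B)
  with inv_N show ?thesis unfolding R_eq M_eq by blast
qed

end
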